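(* Let $N$ be a positive integer. Then $${}_{7}\phi_{6}\left[\begin{matrix}k,\,\frac{qa}{k},\,\frac{k}{\sqrt{a}},\,-\frac{k}{\sqrt{a}},\,k\sqrt{\frac{q}{a}},\,-k\sqrt{\frac{q}{a}},\,q^{-N}\\ \frac{k^2}{a},\,\sqrt{aq},\,-\sqrt{aq},\,q\sqrt{a},\,-q\sqrt{a},\,\frac{k^2q^{-N}}{a^2}\end{matrix};q,q\right]$$ $$=\frac{(qa/k,\,qa^2/k;q)_N}{(qa,\,qa^2/k^2;q)_N}\;{}_{7}\phi_{6}\left[\begin{matrix}\frac{qa^2}{k^2},\,\sqrt{k},\,-\sqrt{k},\,\sqrt{kq},\,-\sqrt{kq},\,\frac{a^2q^{N+1}}{k},\,q^{-N}\\ a\sqrt{\frac{q}{k}},\,-a\sqrt{\frac{q}{k}},\,\frac{aq}{\sqrt{k}},\,-\frac{aq}{\sqrt{k}},\,\frac{kq^{-N}}{a},\,aq^{N+1}\end{matrix};q,q\right].$$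
   Context: For an integer $n\ge 0$, $(x;q)_n=\prod_{i=0}^{n-1}(1-xq^i)$ and $(x_1,\dots,x_m;q)_n=\prod_{j=1}^m(x_j;q)_n$. The basic hypergeometric series is ${}_{r+1}\phi_r\left[\begin{matrix}a_1,\dots,a_{r+1}\\ b_1,\dots,b_r\end{matrix};q,x\right]=\sum_{n\ge0}\frac{(a_1,\dots,a_{r+1};q)_n}{(q,b_1,\dots,b_r;q)_n}x^n$; when $q^{-N}$ is an upper parameter the series terminates, and the sum is over $0\le n\le N$. Here $q,a,k$ are nonzero complex numbers such that none of the denominators vanish; all square roots are fixed choices. *)

theory Defs
  imports Complex_Main
begin

definition qpoch :: "complex \<Rightarrow> complex \<Rightarrow> nat \<Rightarrow> complex" where
  "qpoch x q n = (\<Prod>i<n. 1 - x * q ^ i)"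

definition qpochs :: "complex list \<Rightarrow> complex \<Rightarrow> nat \<Rightarrow> complex" where
  "qpochs xs q n = (\<Prod>x\<leftarrow>xs. qpoch x q n)"

text \<open>
  The series with upper parameters \<open>as\<close> and lower parameters \<open>bs\<close>, where
  \<open>length as = length bs + 1\<close>. If \<open>q \<noteq> 0\<close> and \<open>q\<close> to the power \<open>-N\<close> is an upper
  parameter, every term with index \<open>n > N\<close> has numerator 0 and hence is 0 (also where its
  denominator vanishes, as \<open>0 / 0 = 0\<close>), so the value is the sum over \<open>n \<le> N\<close>; see
  \<open>basic_hyp_terminating\<close> below.
\<close>

definition basic_hyp ::
  "complex list \<Rightarrow> complex list \<Rightarrow> complex \<Rightarrow> complex \<Rightarrow> complex" where
  "basic_hyp as bs q x = (\<Sum>n. qpochs as q n / qpochs (q # bs) q n * x ^ n)"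

lemma qpoch_powi_minus_eq_0:
  assumes "q \<noteq> 0" "N < n"
  shows "qpoch (q powi (- int N)) q n = 0"
proof -
  have "1 - q powi (- int N) * q ^ N = 0"
    using assms(1) by (simp add: power_int_minus)
  then show ?thesis
    unfolding qpoch_def using assms(2) by (auto simp: prod_zero_iff)
qed

lemma basic_hyp_terminating:
  assumes "q \<noteq> 0" "q powi (- int N) \<in> set as"
  shows "basic_hyp as bs q x = (\<Sum>n\<le>N. qpochs as q n / qpochs (q # bs) q n * x ^ n)"
  unfolding basic_hyp_def
proof (rule suminf_finite)
  fix n assume "n \<notin> {..N}"
  then have "qpoch (q powi (- int N)) q n = 0"
    using assms(1) by (simp add: qpoch_powi_minus_eq_0)
  then have "qpochs as q n = 0"
    unfolding qpochs_def using assms(2) by (force simp: prod_list_zero_iff)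
  then show "qpochs as q n / qpochs (q # bs) q n * x ^ n = 0"
    by simp
qed simp

end

theory Submission
  imports Defs
begin

text \<open>
  Put \<open>c = q a\<^sup>2 / k\<^sup>2\<close>. Reversing the factors that contain \<open>q\<close> to the power \<open>-N\<close> turns the
  left-hand side into a convolution of \<open>(c; q)\<^sub>m / (q; q)\<^sub>m\<close> with a quotient of shifted factorials.
  By the q-Pfaff-Saalschuetz sum, that quotient is itself a sum over some \<open>j \<le> n\<close>. After
  interchanging the two summations, the sum over \<open>n\<close> is again of Saalschuetz type, and
  evaluating it leaves the right-hand side.
\<close>

section \<open>Shifted factorials: splitting, merging square-root parameters, reversal\<close>

lemma qpoch_0 [simp]: "qpoch x q 0 = 1"
  by (simp add: qpoch_def)

lemma qpoch_Suc: "qpoch x q (Suc n) = qpoch x q n * (1 - x * q ^ n)"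
  by (simp add: qpoch_def)

lemma qpoch_add: "qpoch x q (m + n) = qpoch x q m * qpoch (x * q ^ m) q n"
  by (induction n) (simp_all add: qpoch_Suc power_add mult_ac)

lemma qpoch_nonzero_mono:
  assumes "qpoch x q N \<noteq> 0" "n \<le> N"
  shows "qpoch x q n \<noteq> 0"
  using assms qpoch_add[of x q n "N - n"] by auto

text \<open>The parameters \<open>x\<close> and \<open>- x\<close> contribute the even-indexed
  factors \<open>1 - x ^ 2 * q ^ (2 * i)\<close>, and \<open>y\<close> and \<open>- y\<close> the
  odd-indexed ones, because \<open>y\<close> is \<open>x\<close> times a square root of
  \<open>q\<close>.\<close>

lemma qpoch_quadruple:
  assumes "y ^ 2 = x ^ 2 * q"
  shows "qpoch x q n * qpoch (- x) q n * qpoch y q n * qpoch (- y) q n = qpoch (x ^ 2) q (2 * n)"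
proof (induction n)
  case (Suc n)
  have "(1 - x * q ^ n) * (1 + x * q ^ n) * ((1 - y * q ^ n) * (1 + y * q ^ n))
      = (1 - x ^ 2 * q ^ (2 * n)) * (1 - y ^ 2 * q ^ (2 * n))"
    unfolding power_even_eq by algebra
  also have "\<dots> = (1 - x ^ 2 * q ^ (2 * n)) * (1 - x ^ 2 * q ^ Suc (2 * n))"
    by (simp add: assms mult_ac)
  finally have step: "(1 - x * q ^ n) * (1 + x * q ^ n) * ((1 - y * q ^ n) * (1 + y * q ^ n))
      = (1 - x ^ 2 * q ^ (2 * n)) * (1 - x ^ 2 * q ^ Suc (2 * n))" .
  have "qpoch x q (Suc n) * qpoch (- x) q (Suc n) * qpoch y q (Suc n) * qpoch (- y) q (Suc n)
      = (qpoch x q n * qpoch (- x) q n * qpoch y q n * qpoch (- y) q n)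
        * ((1 - x * q ^ n) * (1 + x * q ^ n) * ((1 - y * q ^ n) * (1 + y * q ^ n)))"
    by (simp add: qpoch_Suc mult_ac)
  also have "\<dots> = qpoch (x ^ 2) q (2 * Suc n)"
    unfolding Suc.IH step by (simp add: qpoch_Suc mult_ac)
  finally show ?case .
qed simp

text \<open>Each factor \<open>1 - x * q powi (i - N)\<close> equals
  \<open>- x * q powi (i - N)\<close> times \<open>1 - q / x * q ^ (N - 1 - i)\<close>, and the
  latter are the last \<open>n\<close> factors of \<open>qpoch (q / x) q N\<close>. The product form
  carries nonvanishing from one side to the other.\<close>

lemma qpoch_reverse:
  assumes "q \<noteq> 0" "x \<noteq> 0" "n \<le> N"
  shows "qpoch (x * q powi (- int N)) q n * qpoch (q / x) q (N - n)
       = qpoch (q / x) q N * (- x) ^ n * (\<Prod>i<n. q powi (int i - int N))"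
  using assms(3)
proof (induction n)
  case (Suc n)
  define d where "d = N - Suc n"
  have N: "N - n = Suc d" "N = d + Suc n"
    using Suc.prems by (auto simp: d_def)
  have e: "q powi (int n - int N) = inverse (q ^ Suc d)"
  proof -
    have "int n - int N = - int (Suc d)"
      using N by simp
    then show ?thesis
      by (simp only: power_int_minus power_int_of_nat)
  qed
  have "q powi (- int N) * q ^ n = q powi (int n - int N)"
    using assms(1) by (simp add: power_int_diff power_int_minus field_simps)
  then have f: "1 - x * q powi (- int N) * q ^ n
      = - x * q powi (int n - int N) * (1 - q / x * q ^ d)"
    using assms(1,2) unfolding e mult.assoc by (simp add: field_simps)
  have "qpoch (x * q powi (- int N)) q (Suc n) * qpoch (q / x) q d
      = (qpoch (x * q powi (- int N)) q n * qpoch (q / x) q (N - n))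
        * (- x * q powi (int n - int N))"
    unfolding qpoch_Suc f N(1) by (simp only: mult_ac)
  also have "\<dots> = qpoch (q / x) q N * (- x) ^ Suc n * (\<Prod>i<Suc n. q powi (int i - int N))"
    using Suc by (simp add: mult_ac)
  finally show ?case
    by (simp add: d_def)
qed simp

text \<open>Reversal is applied with 1 and with \<open>x\<close>. The sign and the product of powers
  of \<open>q\<close> do not depend on \<open>x\<close> and cancel, leaving a convolution kernel in
  \<open>N - n\<close>.\<close>

lemma qpoch_reverse_ratio:
  assumes "q \<noteq> 0" "x \<noteq> 0" "n \<le> N"
    and "qpoch q q N \<noteq> 0" "qpoch (q / x) q N \<noteq> 0"
  shows "qpoch (q powi (- int N)) q n / qpoch (x * q powi (- int N)) q n
       = qpoch q q N / qpoch (q / x) q N * (qpoch (q / x) q (N - n) / qpoch q q (N - n)) / x ^ n"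
proof -
  define e where "e = (- 1) ^ n * (\<Prod>i<n. q powi (int i - int N))"
  have e: "e \<noteq> 0"
    using assms(1) by (simp add: e_def)
  have nz: "qpoch q q (N - n) \<noteq> 0" "qpoch (q / x) q (N - n) \<noteq> 0"
    using assms(4,5) by (auto dest: qpoch_nonzero_mono[of _ _ N "N - n"])
  have z: "qpoch (q powi (- int N)) q n = qpoch q q N * e / qpoch q q (N - n)"
    using qpoch_reverse[of q 1 n N] assms nz by (simp add: e_def field_simps)
  have xz: "qpoch (x * q powi (- int N)) q n
      = qpoch (q / x) q N * x ^ n * e / qpoch (q / x) q (N - n)"
    using qpoch_reverse[of q x n N] assms nz
    by (simp add: e_def field_simps power_minus[of x])
  show ?thesis
    unfolding z xz using e assms nz by (simp add: field_simps)
qed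

section \<open>The q-Pfaff-Saalschuetz sum and the double sum built from it\<close>

text \<open>
  With \<open>C = w A B\<close>, this is the q-Pfaff-Saalschuetz sum of the series with upper parameters
  \<open>A\<close>, \<open>B\<close>, \<open>q\<close> to the power \<open>-M\<close> and lower parameters \<open>C\<close>, \<open>q\<close> to the power \<open>1-M\<close> divided by
  \<open>w\<close>, written as a convolution.
\<close>

lemma q_Pfaff_Saalschuetz:
  assumes "qpoch q q M \<noteq> 0" "qpoch (w * A * B) q M \<noteq> 0"
  shows "(\<Sum>m\<le>M. qpoch w q (M - m) / qpoch q q (M - m) * w ^ m
            * (qpoch A q m * qpoch B q m / (qpoch q q m * qpoch (w * A * B) q m)))
       = qpoch (w * A) q M * qpoch (w * B) q M / (qpoch q q M * qpoch (w * A * B) q M)"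
  using assms
proof (induction M)
  case (Suc M)
  define C where "C = w * A * B"
  define t where "t M m = qpoch w q (M - m) / qpoch q q (M - m) * w ^ m
    * (qpoch A q m * qpoch B q m / (qpoch q q m * qpoch C q m))" for M m
  \<comment> \<open>The claimed right-hand side at \<open>M + 1\<close> is \<open>b / a\<close>
    times its value at \<open>M\<close>, so a first-order recurrence for the sum suffices.\<close>
  define a where "a = (1 - q ^ Suc M) * (1 - C * q ^ M)"
  define b where "b = (1 - w * A * q ^ M) * (1 - w * B * q ^ M)"
  \<comment> \<open>The certificate \<open>g\<close>, found by the q-Zeilberger method, makes \<open>a t(M+1, m) - b t(M, m)\<close>
    telescope in \<open>m\<close>.\<close>
  define g where "g m = - (q ^ (M - m)) * (qpoch w q (M - m) / qpoch q q (M - m)) * w ^ Suc m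
    * (qpoch A q (Suc m) * qpoch B q (Suc m) / (qpoch q q m * qpoch C q m))" for m
  have nz: "qpoch q q m \<noteq> 0" "qpoch C q m \<noteq> 0" if "m \<le> Suc M" for m
    using Suc.prems[THEN qpoch_nonzero_mono, OF that] by (simp_all add: C_def)
  have nz': "1 - q * q ^ m \<noteq> 0" "1 - C * q ^ m \<noteq> 0" if "m \<le> M" for m
    using nz[of "Suc m"] that by (auto simp: qpoch_Suc)
  have tele: "(\<Sum>i\<le>m. a * t (Suc M) i - b * t M i) = g m" if "m \<le> M" for m
    using that
  proof (induction m)
    case 0
    have "a * t (Suc M) 0 - b * t M 0
        = qpoch w q M / qpoch q q M * ((1 - C * q ^ M) * (1 - w * q ^ M) - b)"
      using nz'[of M] nz[of M] unfolding t_def a_def by (simp add: qpoch_Suc field_simps)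
    \<comment> \<open>The balancing condition \<open>C = w * A * B\<close> cancels the terms in
      \<open>q ^ (2 * M)\<close>.\<close>
    also have "(1 - C * q ^ M) * (1 - w * q ^ M) - b = - (q ^ M) * w * ((1 - A) * (1 - B))"
      unfolding b_def C_def by algebra
    finally show ?case
      unfolding g_def by (simp add: qpoch_Suc)
  next
    case (Suc m)
    define d where "d = M - Suc m"
    define x where "x = q ^ m"
    define y where "y = q ^ d"
    have M: "M = d + Suc m"
      using Suc.prems by (simp add: d_def)
    have diffs: "M - Suc m = d" "M - m = Suc d" "Suc M - Suc m = Suc d"
      using Suc.prems by (auto simp: d_def)
    \<comment> \<open>All four terms of the telescoping step are polynomial multiples of
      \<open>u\<close>, which reduces the step to a polynomial identity in \<open>x\<close> and
      \<open>y\<close>.\<close>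
    define u where "u = qpoch w q d / qpoch q q (Suc d) * w ^ Suc m
      * (qpoch A q (Suc m) * qpoch B q (Suc m) / (qpoch q q (Suc m) * qpoch C q (Suc m)))"
    have nzd: "1 - q * y \<noteq> 0" "1 - q * x \<noteq> 0" "1 - C * x \<noteq> 0"
      "qpoch q q d \<noteq> 0" "qpoch q q m \<noteq> 0" "qpoch C q m \<noteq> 0"
      using nz'[of d] nz'[of m] nz[of d] nz[of m] M by (auto simp: x_def y_def)
    have g1: "g m = - (q * y) * (1 - w * y) * (1 - q * x) * (1 - C * x) * u"
      unfolding g_def diffs u_def using nzd
      by (simp add: qpoch_Suc divide_simps flip: x_def y_def)
    have g2: "g (Suc m) = - y * w * (1 - A * (q * x)) * (1 - B * (q * x)) * (1 - q * y) * u"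
      unfolding g_def diffs u_def using nzd
      by (simp add: qpoch_Suc divide_simps flip: x_def y_def)
    have t1: "t (Suc M) (Suc m) = (1 - w * y) * u"
      unfolding t_def diffs u_def using nzd
      by (simp add: qpoch_Suc divide_simps flip: x_def y_def)
    have t2: "t M (Suc m) = (1 - q * y) * u"
      unfolding t_def diffs u_def using nzd
      by (simp add: qpoch_Suc divide_simps flip: x_def y_def)
    have qM: "q ^ M = q * x * y"
      by (simp add: M x_def y_def power_add)
    have "g m + (a * t (Suc M) (Suc m) - b * t M (Suc m)) = g (Suc m)"
      unfolding g1 g2 t1 t2 a_def b_def power_Suc qM C_def by algebra
    then show ?case
      using Suc by simp
  qed
  \<comment> \<open>The top term is treated apart: \<open>t M (Suc M)\<close> lies outside the sum
    for \<open>M\<close> and, since subtraction truncates, need not be 0.\<close>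
  have last: "a * t (Suc M) (Suc M) = - g M"
    using nz'[of M] nz[of M] unfolding t_def a_def g_def
    by (simp add: qpoch_Suc divide_simps)
  have "a * (\<Sum>m\<le>Suc M. t (Suc M) m) - b * (\<Sum>m\<le>M. t M m)
      = (\<Sum>m\<le>M. a * t (Suc M) m - b * t M m) + a * t (Suc M) (Suc M)"
    by (simp add: sum_distrib_left sum_subtractf distrib_left)
  also have "\<dots> = 0"
    using tele[of M] last by simp
  finally have rec: "a * (\<Sum>m\<le>Suc M. t (Suc M) m) = b * (\<Sum>m\<le>M. t M m)"
    by simp
  have IH: "(\<Sum>m\<le>M. t M m)
      = qpoch (w * A) q M * qpoch (w * B) q M / (qpoch q q M * qpoch C q M)"
    using Suc.IH nz[of M] unfolding t_def C_def by simp
  have "a \<noteq> 0"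
    using nz'[of M] by (simp add: a_def)
  then have "(\<Sum>m\<le>Suc M. t (Suc M) m)
      = b * (qpoch (w * A) q M * qpoch (w * B) q M / (qpoch q q M * qpoch C q M)) / a"
    using rec unfolding IH by (metis nonzero_mult_div_cancel_left)
  also have "\<dots> = qpoch (w * A) q (Suc M) * qpoch (w * B) q (Suc M)
      / (qpoch q q (Suc M) * qpoch C q (Suc M))"
    unfolding a_def b_def by (simp add: qpoch_Suc mult_ac)
  finally show ?case
    unfolding t_def C_def .
qed simp

text \<open>Both sides are iterated sums of one array \<open>T n j\<close> over
  \<open>j \<le> n \<le> N\<close>. Each inner sum is of Saalschuetz type; the balancing condition
  in both cases comes from \<open>c * k * (k / a) = a * q\<close>.\<close>

lemma qpoch_convolution_transform:
  fixes a k q :: complex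
  defines "c \<equiv> q * a ^ 2 / k ^ 2"
  assumes "a \<noteq> 0" "k \<noteq> 0" "qpoch q q N \<noteq> 0" "qpoch (a * q) q (2 * N) \<noteq> 0"
  shows "(\<Sum>n\<le>N. qpoch c q (N - n) / qpoch q q (N - n) * c ^ n
            * (qpoch k q n * qpoch (q * a / k) q n * qpoch (k ^ 2 / a * q ^ n) q n
               / (qpoch q q n * qpoch (a * q) q (2 * n))))
       = (\<Sum>j\<le>N. qpoch (q * a / k) q (N - j) * qpoch (q * a ^ 2 / k * q ^ (2 * j)) q (N - j)
            * qpoch c q j * qpoch k q (2 * j) * (q * a / k) ^ j
            / (qpoch q q (N - j) * qpoch (a * q) q (N + j) * qpoch q q j))"
    (is "(\<Sum>n\<le>N. ?L n) = (\<Sum>j\<le>N. ?R j)")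
proof -
  \<comment> \<open>The indices are coupled through the kernel in \<open>n - j\<close> and the
    quotient of factorials of length \<open>n + j\<close>. The latter splits at \<open>n\<close> for
    the sum over \<open>j\<close>, and at \<open>2 * j\<close> for the sum over
    \<open>m = n - j\<close>.\<close>
  define T where "T n j = qpoch c q (N - n) / qpoch q q (N - n) * c ^ n
    * (qpoch (k / a) q (n - j) / qpoch q q (n - j) * (k / a) ^ j
       * (qpoch c q j * qpoch k q (n + j) / (qpoch q q j * qpoch (a * q) q (n + j))))" for n j
  have nzq: "qpoch q q n \<noteq> 0" if "n \<le> N" for n
    using assms(4) that by (rule qpoch_nonzero_mono)
  have nza: "qpoch (a * q) q n \<noteq> 0" if "n \<le> 2 * N" for n
    using assms(5) that by (rule qpoch_nonzero_mono)
  have L: "?L n = (\<Sum>j\<le>n. T n j)" if n: "n \<le> N" for n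
  proof -
    have params: "k / a * c * (k * q ^ n) = a * q * q ^ n" "k / a * c = q * a / k"
      "k / a * (k * q ^ n) = k ^ 2 / a * q ^ n"
      using assms(2,3) by (auto simp: c_def field_simps power2_eq_square)
    have split: "qpoch (a * q) q (n + j) = qpoch (a * q) q n * qpoch (a * q * q ^ n) q j"
      "qpoch k q (n + j) = qpoch k q n * qpoch (k * q ^ n) q j" for j
      by (simp_all add: qpoch_add)
    have nz: "qpoch (a * q * q ^ n) q n \<noteq> 0"
      using nza[of "n + n"] n by (simp add: qpoch_add)
    have "(\<Sum>j\<le>n. T n j) = qpoch c q (N - n) / qpoch q q (N - n) * c ^ n
      * (qpoch k q n / qpoch (a * q) q n)
      * (\<Sum>j\<le>n. qpoch (k / a) q (n - j) / qpoch q q (n - j) * (k / a) ^ j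
          * (qpoch c q j * qpoch (k * q ^ n) q j
             / (qpoch q q j * qpoch (k / a * c * (k * q ^ n)) q j)))"
      unfolding T_def split sum_distrib_left params(1) by (intro sum.cong) (simp_all add: mult_ac)
    also have "\<dots> = ?L n"
      using q_Pfaff_Saalschuetz[of q n "k / a" c "k * q ^ n"] nz nzq[OF n]
      unfolding params(1) unfolding params(2,3) mult_2 qpoch_add by (simp add: mult_ac)
    finally show ?thesis by simp
  qed
  have R: "(\<Sum>m\<le>N - j. T (m + j) j) = ?R j" if j: "j \<le> N" for j
  proof -
    define K where "K = k * q ^ (2 * j)"
    have params: "c * K * (k / a) = a * q * q ^ (2 * j)"
      "c * K = q * a ^ 2 / k * q ^ (2 * j)" "c * (k / a) = q * a / k"
      using assms(2,3) by (auto simp: c_def K_def field_simps power2_eq_square)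
    have split: "qpoch (a * q) q (m + j + j)
        = qpoch (a * q) q (2 * j) * qpoch (a * q * q ^ (2 * j)) q m"
      "qpoch k q (m + j + j) = qpoch k q (2 * j) * qpoch K q m" for m
      using qpoch_add[of _ q "2 * j" m] by (simp_all add: K_def mult_2 add_ac)
    have splitN: "qpoch (a * q) q (N + j)
        = qpoch (a * q) q (2 * j) * qpoch (a * q * q ^ (2 * j)) q (N - j)"
      using split(1)[of "N - j"] j by simp
    have nz: "qpoch (a * q * q ^ (2 * j)) q (N - j) \<noteq> 0"
      using nza[of "N + j"] j by (simp add: splitN)
    \<comment> \<open>Since \<open>c * (k / a) = q * a / k\<close>, the powers
      \<open>c ^ (m + j)\<close> and \<open>(k / a) ^ j\<close> combine to
      \<open>c ^ m * (q * a / k) ^ j\<close>.\<close>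
    have "T (m + j) j = qpoch c q j * qpoch k q (2 * j) * (q * a / k) ^ j
          / (qpoch q q j * qpoch (a * q) q (2 * j))
        * (qpoch c q (N - j - m) / qpoch q q (N - j - m) * c ^ m
           * (qpoch K q m * qpoch (k / a) q m / (qpoch q q m * qpoch (c * K * (k / a)) q m)))" for m
      unfolding T_def split params(1) params(3)[symmetric]
      by (simp add: power_add power_mult_distrib power_divide add.commute mult_ac)
    then have "(\<Sum>m\<le>N - j. T (m + j) j) = qpoch c q j * qpoch k q (2 * j) * (q * a / k) ^ j
          / (qpoch q q j * qpoch (a * q) q (2 * j))
        * (\<Sum>m\<le>N - j. qpoch c q (N - j - m) / qpoch q q (N - j - m) * c ^ m
           * (qpoch K q m * qpoch (k / a) q m / (qpoch q q m * qpoch (c * K * (k / a)) q m)))"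
      by (simp add: sum_distrib_left)
    also have "\<dots> = ?R j"
      using q_Pfaff_Saalschuetz[of q "N - j" c K "k / a"] nz nzq[of "N - j"]
      unfolding params(1) unfolding params(2,3) splitN by (simp add: mult_ac)
    finally show ?thesis .
  qed
  have "(\<Sum>n\<le>N. ?L n) = (\<Sum>n\<le>N. \<Sum>j\<le>n. T n j)"
    by (intro sum.cong refl L) simp
  also have "\<dots> = (\<Sum>j\<le>N. \<Sum>n = j..N. T n j)"
    by (induction N) (auto simp: sum.distrib)
  also have "\<dots> = (\<Sum>j\<le>N. \<Sum>m\<le>N - j. T (m + j) j)"
  proof (rule sum.cong)
    fix j assume "j \<in> {..N}"
    then show "(\<Sum>n = j..N. T n j) = (\<Sum>m\<le>N - j. T (m + j) j)"
      using sum.shift_bounds_cl_nat_ivl[of "\<lambda>n. T n j" 0 j "N - j"]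
      by (simp add: atMost_atLeast0)
  qed simp
  also have "\<dots> = (\<Sum>j\<le>N. ?R j)"
    by (intro sum.cong refl R) simp
  finally show ?thesis .
qed

section \<open>Termwise reduction of the two series to the double-sum identity\<close>

theorem corollary11:
  fixes q a k :: complex and N :: nat
    and sqrt_a sqrt_aq sqrt_q_over_a sqrt_k sqrt_kq sqrt_q_over_k :: complex
  assumes "N > 0"
    and "q \<noteq> 0" and "a \<noteq> 0" and "k \<noteq> 0"
    and "sqrt_a ^ 2 = a" and "sqrt_aq ^ 2 = a * q" and "sqrt_q_over_a ^ 2 = q / a"
    and "sqrt_k ^ 2 = k" and "sqrt_kq ^ 2 = k * q" and "sqrt_q_over_k ^ 2 = q / k"
    and "qpochs [q, k ^ 2 / a, sqrt_aq, - sqrt_aq, q * sqrt_a, - q * sqrt_a,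
                 k ^ 2 * q powi (- int N) / a ^ 2] q N \<noteq> 0"
    and "qpochs [q * a, q * a ^ 2 / k ^ 2] q N \<noteq> 0"
    and "qpochs [q, a * sqrt_q_over_k, - a * sqrt_q_over_k, a * q / sqrt_k, - a * q / sqrt_k,
                 k * q powi (- int N) / a, a * q ^ (N + 1)] q N \<noteq> 0"
  shows "basic_hyp
           [k, q * a / k, k / sqrt_a, - k / sqrt_a, k * sqrt_q_over_a, - k * sqrt_q_over_a,
            q powi (- int N)]
           [k ^ 2 / a, sqrt_aq, - sqrt_aq, q * sqrt_a, - q * sqrt_a,
            k ^ 2 * q powi (- int N) / a ^ 2]
           q q
       = qpochs [q * a / k, q * a ^ 2 / k] q N / qpochs [q * a, q * a ^ 2 / k ^ 2] q N
         * basic_hyp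
           [q * a ^ 2 / k ^ 2, sqrt_k, - sqrt_k, sqrt_kq, - sqrt_kq, a ^ 2 * q ^ (N + 1) / k,
            q powi (- int N)]
           [a * sqrt_q_over_k, - a * sqrt_q_over_k, a * q / sqrt_k, - a * q / sqrt_k,
            k * q powi (- int N) / a, a * q ^ (N + 1)]
           q q"
proof -
  \<comment> \<open>\<open>c\<close> is \<open>q / x\<close> for \<open>x = k ^ 2 / a ^ 2\<close>,
    as produced by reversing the last lower parameter on the left. The four square-root lower
    parameters on the right merge into \<open>k'\<close>, which equals \<open>c * k\<close>.\<close>
  define c where "c = q * a ^ 2 / k ^ 2"
  define k' where "k' = q * a ^ 2 / k"
  define z where "z = q powi (- int N)"
  note q0 = assms(2) and a0 = assms(3) and k0 = assms(4)
  have [simp]: "sqrt_a \<noteq> 0" "sqrt_k \<noteq> 0"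
    using assms(5,8) a0 k0 by auto
  have quads:
    "qpoch (k / sqrt_a) q n * qpoch (- k / sqrt_a) q n * qpoch (k * sqrt_q_over_a) q n
       * qpoch (- k * sqrt_q_over_a) q n = qpoch (k ^ 2 / a) q (2 * n)"
    "qpoch sqrt_aq q n * qpoch (- sqrt_aq) q n * qpoch (q * sqrt_a) q n
       * qpoch (- q * sqrt_a) q n = qpoch (a * q) q (2 * n)"
    "qpoch sqrt_k q n * qpoch (- sqrt_k) q n * qpoch sqrt_kq q n
       * qpoch (- sqrt_kq) q n = qpoch k q (2 * n)"
    "qpoch (a * sqrt_q_over_k) q n * qpoch (- a * sqrt_q_over_k) q n * qpoch (a * q / sqrt_k) q n
       * qpoch (- a * q / sqrt_k) q n = qpoch k' q (2 * n)" for n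
  proof -
    have "(k / sqrt_a) ^ 2 = k ^ 2 / a" "(k * sqrt_q_over_a) ^ 2 = k ^ 2 / a * q"
      "(q * sqrt_a) ^ 2 = a * q * q" "(a * sqrt_q_over_k) ^ 2 = k'"
      "(a * q / sqrt_k) ^ 2 = k' * q"
      unfolding power_mult_distrib power_divide assms(5-10) k'_def
      by (simp_all add: power2_eq_square)
    then show
      "qpoch (k / sqrt_a) q n * qpoch (- k / sqrt_a) q n * qpoch (k * sqrt_q_over_a) q n
         * qpoch (- k * sqrt_q_over_a) q n = qpoch (k ^ 2 / a) q (2 * n)"
      "qpoch sqrt_aq q n * qpoch (- sqrt_aq) q n * qpoch (q * sqrt_a) q n
         * qpoch (- q * sqrt_a) q n = qpoch (a * q) q (2 * n)"
      "qpoch sqrt_k q n * qpoch (- sqrt_k) q n * qpoch sqrt_kq q n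
         * qpoch (- sqrt_kq) q n = qpoch k q (2 * n)"
      "qpoch (a * sqrt_q_over_k) q n * qpoch (- a * sqrt_q_over_k) q n * qpoch (a * q / sqrt_k) q n
         * qpoch (- a * q / sqrt_k) q n = qpoch k' q (2 * n)"
      using qpoch_quadruple[of "k * sqrt_q_over_a" "k / sqrt_a" q n]
        qpoch_quadruple[of "q * sqrt_a" sqrt_aq q n]
        qpoch_quadruple[of sqrt_kq sqrt_k q n]
        qpoch_quadruple[of "a * q / sqrt_k" "a * sqrt_q_over_k" q n]
      by (simp_all add: assms(6,8,9))
  qed
  have nzs: "qpoch q q N \<noteq> 0" "qpoch (k ^ 2 / a) q N \<noteq> 0" "qpoch (a * q) q (2 * N) \<noteq> 0"
    "qpoch c q N \<noteq> 0" "qpoch k' q (2 * N) \<noteq> 0" "qpoch (k / a * z) q N \<noteq> 0"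
    using assms(11-13) unfolding quads[symmetric] by (auto simp: qpochs_def c_def z_def)
  \<comment> \<open>Full reversal (\<open>n = N\<close>) of the lower parameter
    \<open>k * z / a\<close> gives this.\<close>
  have "qpoch (q * a / k) q N \<noteq> 0"
    using qpoch_reverse[of q "k / a" N N] nzs(6) q0 a0 k0 by (auto simp: z_def)
  note nzs = nzs this
  \<comment> \<open>The square-root numerators merge to length \<open>2 * n\<close>; dividing by
    \<open>qpoch (k ^ 2 / a) q n\<close> leaves the upper half. Reversal with
    \<open>x = k ^ 2 / a ^ 2\<close> gives the kernel, and \<open>q ^ n / x ^ n\<close> is
    \<open>c ^ n\<close>.\<close>
  have lhs: "qpochs [k, q * a / k, k / sqrt_a, - k / sqrt_a, k * sqrt_q_over_a,
        - k * sqrt_q_over_a, z] q n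
      / qpochs [q, k ^ 2 / a, sqrt_aq, - sqrt_aq, q * sqrt_a, - q * sqrt_a, k ^ 2 * z / a ^ 2] q n
        * q ^ n
      = qpoch q q N / qpoch c q N * (qpoch c q (N - n) / qpoch q q (N - n) * c ^ n
          * (qpoch k q n * qpoch (q * a / k) q n * qpoch (k ^ 2 / a * q ^ n) q n
             / (qpoch q q n * qpoch (a * q) q (2 * n))))" (is "?l = ?r") if n: "n \<le> N" for n
  proof -
    have nz: "qpoch (k ^ 2 / a) q n \<noteq> 0"
      using nzs(2) n by (rule qpoch_nonzero_mono)
    have double: "qpoch (k ^ 2 / a) q (2 * n)
        = qpoch (k ^ 2 / a) q n * qpoch (k ^ 2 / a * q ^ n) q n"
      by (simp only: mult_2 qpoch_add)
    have c: "q / (k ^ 2 / a ^ 2) = c" "c ^ n = q ^ n / (k ^ 2 / a ^ 2) ^ n"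
      by (simp_all add: c_def power_divide power_mult_distrib)
    have "?l = qpoch k q n * qpoch (q * a / k) q n
        * (qpoch (k / sqrt_a) q n * qpoch (- k / sqrt_a) q n * qpoch (k * sqrt_q_over_a) q n
           * qpoch (- k * sqrt_q_over_a) q n)
        / (qpoch q q n * qpoch (k ^ 2 / a) q n
           * (qpoch sqrt_aq q n * qpoch (- sqrt_aq) q n * qpoch (q * sqrt_a) q n
              * qpoch (- q * sqrt_a) q n))
        * (qpoch z q n / qpoch (k ^ 2 / a ^ 2 * z) q n) * q ^ n"
      by (simp add: qpochs_def mult_ac)
    also have "\<dots> = ?r"
      unfolding quads double z_def c(2)
      using nz qpoch_reverse_ratio[of q "k ^ 2 / a ^ 2" n N] n q0 a0 k0 nzs(1,4)
      unfolding c(1) by (simp add: mult_ac)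
    finally show ?thesis .
  qed
  \<comment> \<open>The prefactor is absorbed into each term: \<open>qpoch k' q N\<close> extends to
    length \<open>N + j\<close> and then loses its first \<open>2 * j\<close> factors to the merged
    denominators, \<open>qpoch (q * a) q N\<close> extends to length \<open>N + j\<close>, and
    \<open>qpoch (q * a / k) q N\<close> cancels in the reversal with
    \<open>x = k / a\<close>.\<close>
  have rhs: "qpochs [q * a / k, q * a ^ 2 / k] q N / qpochs [q * a, q * a ^ 2 / k ^ 2] q N
      * (qpochs [q * a ^ 2 / k ^ 2, sqrt_k, - sqrt_k, sqrt_kq, - sqrt_kq,
           a ^ 2 * q ^ (N + 1) / k, z] q j
         / qpochs [q, a * sqrt_q_over_k, - a * sqrt_q_over_k, a * q / sqrt_k, - a * q / sqrt_k,
             k * z / a, a * q ^ (N + 1)] q j * q ^ j)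
      = qpoch q q N / qpoch c q N
        * (qpoch (q * a / k) q (N - j) * qpoch (k' * q ^ (2 * j)) q (N - j)
            * qpoch c q j * qpoch k q (2 * j) * (q * a / k) ^ j
            / (qpoch q q (N - j) * qpoch (a * q) q (N + j) * qpoch q q j))"
    (is "?l = ?r") if j: "j \<le> N" for j
  proof -
    have nz: "qpoch k' q (2 * j) \<noteq> 0"
      using nzs(5) by (rule qpoch_nonzero_mono) (use j in simp)
    have aq: "qpoch (a * q) q (N + j) = qpoch (q * a) q N * qpoch (a * q ^ (N + 1)) q j"
      by (simp add: qpoch_add mult_ac)
    have "qpoch k' q N * qpoch (a ^ 2 * q ^ (N + 1) / k) q j = qpoch k' q (N + j)"
      by (simp add: qpoch_add k'_def mult_ac)
    also have "\<dots> = qpoch k' q (2 * j) * qpoch (k' * q ^ (2 * j)) q (N - j)"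
      using qpoch_add[of k' q "2 * j" "N - j"] j by (simp add: mult_2 add.commute)
    finally have k': "qpoch k' q N * qpoch (a ^ 2 * q ^ (N + 1) / k) q j
        = qpoch k' q (2 * j) * qpoch (k' * q ^ (2 * j)) q (N - j)" .
    have p: "q / (k / a) = q * a / k" "(q * a / k) ^ j = q ^ j / (k / a) ^ j"
      by (simp_all add: power_divide power_mult_distrib)
    have "?l = qpoch (q * a / k) q N / (qpoch (q * a) q N * qpoch c q N)
        * (qpoch k' q N * qpoch (a ^ 2 * q ^ (N + 1) / k) q j)
        * (qpoch c q j * (qpoch sqrt_k q j * qpoch (- sqrt_k) q j * qpoch sqrt_kq q j
             * qpoch (- sqrt_kq) q j)
           / (qpoch q q j * (qpoch (a * sqrt_q_over_k) q j * qpoch (- a * sqrt_q_over_k) q j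
               * qpoch (a * q / sqrt_k) q j * qpoch (- a * q / sqrt_k) q j)
              * qpoch (a * q ^ (N + 1)) q j))
        * (qpoch z q j / qpoch (k / a * z) q j) * q ^ j"
      by (simp add: qpochs_def c_def k'_def mult_ac)
    also have "\<dots> = ?r"
      unfolding quads k' z_def aq p(2)
      using nz qpoch_reverse_ratio[of q "k / a" j N] j q0 a0 k0 nzs(1,7)
      unfolding p(1) by (simp add: mult_ac)
    finally show ?thesis .
  qed
  note transform = qpoch_convolution_transform[OF a0 k0 nzs(1,3), folded c_def k'_def]
  have terminating: "basic_hyp us vs q q = (\<Sum>n\<le>N. qpochs us q n / qpochs (q # vs) q n * q ^ n)"
    if "z \<in> set us" for us vs
    using that q0 unfolding z_def by (intro basic_hyp_terminating)
  show ?thesis (is "basic_hyp ?us ?vs q q = ?pre * basic_hyp ?us' ?vs' q q")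
  proof -
    have "basic_hyp ?us ?vs q q = (\<Sum>n\<le>N. qpochs ?us q n / qpochs (q # ?vs) q n * q ^ n)"
      by (rule terminating) (simp add: z_def)
    also have "\<dots> = qpoch q q N / qpoch c q N
        * (\<Sum>n\<le>N. qpoch c q (N - n) / qpoch q q (N - n) * c ^ n
          * (qpoch k q n * qpoch (q * a / k) q n * qpoch (k ^ 2 / a * q ^ n) q n
             / (qpoch q q n * qpoch (a * q) q (2 * n))))"
      unfolding sum_distrib_left z_def[symmetric] by (intro sum.cong refl lhs) simp
    also have "\<dots> = ?pre * (\<Sum>n\<le>N. qpochs ?us' q n / qpochs (q # ?vs') q n * q ^ n)"
      unfolding transform sum_distrib_left z_def[symmetric]
      by (intro sum.cong refl rhs[symmetric]) simp
    also have "(\<Sum>n\<le>N. qpochs ?us' q n / qpochs (q # ?vs') q n * q ^ n) = basic_hyp ?us' ?vs' q q"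
      by (rule terminating[symmetric]) (simp add: z_def)
    finally show ?thesis .
  qed
qed

end
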